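(* Let $G$ be a graph, $R\subseteq V(G)$ with $|R|\ge 2$, and let $T_1,\dots,T_k$ be $R$-Steiner trees of $G$. Then $\{T_1,\dots,T_k\}$ is an $R$-CIST of $G$ if and only if $E(T_i)\cap E(T_j)=\emptyset$ and $\mathrm{int}(T_i)\cap\mathrm{int}(T_j)=\emptyset$ for all distinct $i,j\in[k]$.
   Context: Graphs are finite and connected, may have parallel edges but no loops. For a tree $T$, a vertex $v$ is an internal node if $d_T(v)\ge 2$, and a leaf otherwise; $\mathrm{int}(T)$ and $L(T)$ denote the sets of internal nodes and leaves. For $R\subseteq V(G)$ with $|R|\ge 2$, an $R$-Steiner tree is a subtree $T$ of $G$ with $R\subseteq V(T)$ and $L(T)\subseteq R$. $T(u,v)$ denotes the unique $(u,v)$-path in a tree $T$. An $R$-CIST of $G$ is a set $\{T_1,\dots,T_k\}$ of $R$-Steiner trees such that for every pair of distinct $u,v\in R$ and all distinct $i,j\in[k]$, the paths $T_i(u,v)$ and $T_j(u,v)$ are edge-disjoint and internally vertex-disjoint. *)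

theory Defs
  imports Main
begin

record ('v, 'e) mgraph =
  verts :: "'v set"
  edges :: "'e set"
  ends :: "'e \<Rightarrow> 'v set"

text \<open>Finite undirected graphs. Distinct edges may have the same ends (parallel edges); two
  distinct ends exclude loops.\<close>

definition multigraph :: "('v, 'e) mgraph \<Rightarrow> bool" where
  "multigraph G \<longleftrightarrow> finite (verts G) \<and> finite (edges G) \<and>
     (\<forall>e\<in>edges G. ends G e \<subseteq> verts G \<and> card (ends G e) = 2)"

definition subgraph :: "('v, 'e) mgraph \<Rightarrow> ('v, 'e) mgraph \<Rightarrow> bool" where
  "subgraph H G \<longleftrightarrow> multigraph H \<and> verts H \<subseteq> verts G \<and> edges H \<subseteq> edges G \<and>
     (\<forall>e\<in>edges H. ends H e = ends G e)"

definition degree :: "('v, 'e) mgraph \<Rightarrow> 'v \<Rightarrow> nat" where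
  "degree G v = card {e \<in> edges G. v \<in> ends G e}"

text \<open>A walk is given by its vertex sequence and its edge sequence; the latter is needed to
  tell parallel edges apart.\<close>

definition walk :: "('v, 'e) mgraph \<Rightarrow> 'v list \<times> 'e list \<Rightarrow> bool" where
  "walk G = (\<lambda>(vs, es). length vs = length es + 1 \<and> set vs \<subseteq> verts G \<and> set es \<subseteq> edges G \<and>
     (\<forall>i<length es. ends G (es ! i) = {vs ! i, vs ! Suc i}))"

definition path_betw :: "('v, 'e) mgraph \<Rightarrow> 'v \<Rightarrow> 'v \<Rightarrow> 'v list \<times> 'e list \<Rightarrow> bool" where
  "path_betw G u v p \<longleftrightarrow>
     walk G p \<and> hd (fst p) = u \<and> last (fst p) = v \<and> distinct (fst p)"

text \<open>Two parallel edges form a cycle of length 2; requiring distinct edges rules out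
  traversing a single edge back and forth.\<close>

definition cycle :: "('v, 'e) mgraph \<Rightarrow> 'v list \<times> 'e list \<Rightarrow> bool" where
  "cycle G c \<longleftrightarrow> walk G c \<and> snd c \<noteq> [] \<and> hd (fst c) = last (fst c) \<and>
     distinct (tl (fst c)) \<and> distinct (snd c)"

definition connected_graph :: "('v, 'e) mgraph \<Rightarrow> bool" where
  "connected_graph G \<longleftrightarrow> verts G \<noteq> {} \<and> (\<forall>u\<in>verts G. \<forall>v\<in>verts G. \<exists>p. path_betw G u v p)"

definition tree :: "('v, 'e) mgraph \<Rightarrow> bool" where
  "tree T \<longleftrightarrow> multigraph T \<and> connected_graph T \<and> (\<nexists>c. cycle T c)"

definition internal_nodes :: "('v, 'e) mgraph \<Rightarrow> 'v set" where
  "internal_nodes T = {v \<in> verts T. degree T v \<ge> 2}"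

definition leaves :: "('v, 'e) mgraph \<Rightarrow> 'v set" where
  "leaves T = verts T - internal_nodes T"

definition tree_path :: "('v, 'e) mgraph \<Rightarrow> 'v \<Rightarrow> 'v \<Rightarrow> 'v list \<times> 'e list" where
  "tree_path T u v = (THE p. path_betw T u v p)"

definition inner_verts :: "'v list \<times> 'e list \<Rightarrow> 'v set" where
  "inner_verts p = set (fst p) - {hd (fst p), last (fst p)}"

definition edge_disjoint :: "'v list \<times> 'e list \<Rightarrow> 'v list \<times> 'e list \<Rightarrow> bool" where
  "edge_disjoint p q \<longleftrightarrow> set (snd p) \<inter> set (snd q) = {}"

definition internally_vertex_disjoint :: "'v list \<times> 'e list \<Rightarrow> 'v list \<times> 'e list \<Rightarrow> bool" where
  "internally_vertex_disjoint p q \<longleftrightarrow> inner_verts p \<inter> inner_verts q = {}"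

definition steiner_tree :: "('v, 'e) mgraph \<Rightarrow> 'v set \<Rightarrow> ('v, 'e) mgraph \<Rightarrow> bool" where
  "steiner_tree G R T \<longleftrightarrow> subgraph T G \<and> tree T \<and> R \<subseteq> verts T \<and> leaves T \<subseteq> R"

text \<open>The collection \<open>{T\<^sub>1, \<dots>, T\<^sub>k}\<close> is rendered as the family of \<open>T i\<close> for \<open>i \<in> {1..k}\<close>,
  since the disjointness condition ranges over pairs of distinct indices.\<close>

definition CIST ::
  "('v, 'e) mgraph \<Rightarrow> 'v set \<Rightarrow> nat \<Rightarrow> (nat \<Rightarrow> ('v, 'e) mgraph) \<Rightarrow> bool" where
  "CIST G R k T \<longleftrightarrow> (\<forall>i\<in>{1..k}. steiner_tree G R (T i)) \<and>
     (\<forall>u\<in>R. \<forall>v\<in>R. u \<noteq> v \<longrightarrow>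
       (\<forall>i\<in>{1..k}. \<forall>j\<in>{1..k}. i \<noteq> j \<longrightarrow>
         edge_disjoint (tree_path (T i) u v) (tree_path (T j) u v) \<and>
         internally_vertex_disjoint (tree_path (T i) u v) (tree_path (T j) u v)))"

end

theory Submission
  imports Defs
begin

text \<open>A common edge \<open>e\<close> of two of the trees splits the terminals in each of them into two
  nonempty parts, since every path through \<open>e\<close> extends to a path between two leaves, and leaves
  are terminals; a common internal node \<open>w\<close> likewise splits the terminals other than \<open>w\<close> into at
  least two nonempty parts in each tree. The union of two equivalence relations is full only if
  one of them is, so some pair of terminals is separated in both trees, and the two tree paths
  between them share \<open>e\<close> or \<open>w\<close>. Conversely, an inner vertex of a path has degree at least two.\<close>

section \<open>Two equivalence relations with full union\<close>

text \<open>Suppose each pair is related by \<open>P\<close> or by \<open>Q\<close>, and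
  \<open>P a b\<close> fails. If \<open>Q a x\<close> failed too, then \<open>P a x\<close> and
  \<open>Q a b\<close>; since \<open>P b x\<close> would yield \<open>P a b\<close>, also
  \<open>Q b x\<close>, and \<open>Q a x\<close> follows through b. So a is \<open>Q\<close>-related
  to all of S, and \<open>Q\<close> is full. The points u and v found this way may coincide as far
  as the lemma goes; distinctness is shown where it is applied.\<close>

lemma ex_common_unrelated_pair:
  assumes "symp P" "transp P" "symp Q" "transp Q"
    and "\<exists>a\<in>S. \<exists>b\<in>S. \<not> P a b" and "\<exists>a\<in>S. \<exists>b\<in>S. \<not> Q a b"
  shows "\<exists>u\<in>S. \<exists>v\<in>S. \<not> P u v \<and> \<not> Q u v"
proof (rule ccontr)
  assume "\<not> ?thesis"
  then have PQ: "P x y \<or> Q x y" if "x \<in> S" "y \<in> S" for x y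
    using that by blast
  obtain a b where ab: "a \<in> S" "b \<in> S" "\<not> P a b"
    using assms(5) by blast
  obtain c d where cd: "c \<in> S" "d \<in> S" "\<not> Q c d"
    using assms(6) by blast
  have Qa: "Q a x" if x: "x \<in> S" for x
  proof (rule ccontr)
    assume "\<not> Q a x"
    with PQ ab x have "P a x" "Q a b"
      by blast+
    have "\<not> P b x"
      using \<open>P a x\<close> ab(3) sympD[OF assms(1)] transpD[OF assms(2)] by blast
    with PQ ab(2) x have "Q b x"
      by blast
    with \<open>Q a b\<close> \<open>\<not> Q a x\<close> show False
      using transpD[OF assms(4)] by blast
  qed
  have "Q c d"
    using sympD[OF assms(3) Qa[OF cd(1)]] Qa[OF cd(2)] by (rule transpD[OF assms(4)])
  with cd(3) show False ..
qed

section \<open>Walks and paths\<close>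

lemma walk_single: "walk G ([v], es) \<longleftrightarrow> v \<in> verts G \<and> es = []"
  by (auto simp: walk_def)

lemma walk_Cons:
  "walk G (u # v # vs, e # es) \<longleftrightarrow>
    u \<in> verts G \<and> e \<in> edges G \<and> ends G e = {u, v} \<and> walk G (v # vs, es)"
  by (auto simp: walk_def All_less_Suc2)

text \<open>Structural view of the index-based \<open>walk\<close>, which permits induction on the
  edge list.\<close>

lemma walk_cases:
  assumes "walk G (vs, es)"
  obtains (single) v where "vs = [v]" "es = []" "v \<in> verts G"
  | (step) u v vs' e es' where "vs = u # v # vs'" "es = e # es'" "u \<in> verts G" "e \<in> edges G"
      "ends G e = {u, v}" "walk G (v # vs', es')"
proof (cases es)
  case Nil
  then show ?thesis
    using assms single by (auto simp: walk_def length_Suc_conv)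
next
  case (Cons e es')
  then obtain u v vs' where "vs = u # v # vs'"
    using assms by (auto simp: walk_def length_Suc_conv)
  then show ?thesis
    using assms Cons step by (simp add: walk_Cons)
qed

lemma walk_ends_subset: "walk G (vs, es) \<Longrightarrow> e \<in> set es \<Longrightarrow> ends G e \<subseteq> set vs"
proof -
  assume w: "walk G (vs, es)" and "e \<in> set es"
  then obtain i where i: "i < length es" "e = es ! i"
    by (auto simp: in_set_conv_nth)
  then have "ends G e = {vs ! i, vs ! Suc i}" "vs ! i \<in> set vs" "vs ! Suc i \<in> set vs"
    using w by (auto simp: walk_def)
  then show ?thesis
    by simp
qed

text \<open>The first edge contains the first vertex, while the ends of all later edges lie among
  the later vertices.\<close>

lemma walk_distinct_edges: "walk G (vs, es) \<Longrightarrow> distinct vs \<Longrightarrow> distinct es"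
proof (induction es arbitrary: vs)
  case (Cons e es)
  from Cons.prems(1) show ?case
  proof (cases rule: walk_cases)
    case (step u v vs' e' es')
    then have "e \<notin> set es"
      using walk_ends_subset[of G "v # vs'" es e] Cons.prems(2) by auto
    then show ?thesis
      using step Cons by auto
  qed simp
qed simp

lemma walk_rev:
  assumes "walk G (vs, es)"
  shows "walk G (rev vs, rev es)"
proof -
  have "ends G (rev es ! i) = {rev vs ! i, rev vs ! Suc i}" if "i < length es" for i
  proof -
    \<comment> \<open>Edge i of the reversed walk is edge \<open>?j\<close> of the original, with
      its two ends met in the opposite order.\<close>
    let ?j = "length es - Suc i"
    have "ends G (es ! ?j) = {vs ! ?j, vs ! Suc ?j}"
      using assms that by (simp add: walk_def)
    moreover have "Suc ?j = length vs - Suc i" "?j = length vs - Suc (Suc i)"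
      "Suc i < length vs" "i < length vs"
      using assms that by (auto simp: walk_def)
    ultimately show ?thesis
      using that by (simp add: rev_nth insert_commute)
  qed
  then show ?thesis
    using assms by (simp add: walk_def)
qed

lemma path_betw_rev:
  "path_betw G u v (vs, es) \<Longrightarrow> path_betw G v u (rev vs, rev es)"
  by (auto simp: path_betw_def walk_rev hd_rev last_rev)

lemma path_betw_cases:
  assumes "path_betw G u w (vs, es)"
  obtains (single) "vs = [u]" "es = []" "u \<in> verts G" "u = w"
  | (step) v vs' e es' where "vs = u # v # vs'" "es = e # es'" "u \<in> verts G" "e \<in> edges G"
      "ends G e = {u, v}" "u \<notin> set (v # vs')" "path_betw G v w (v # vs', es')"
proof -
  have "walk G (vs, es)" "hd vs = u" "last vs = w" "distinct vs"
    using assms by (auto simp: path_betw_def)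
  from this(1) show ?thesis
  proof (cases rule: walk_cases)
    case (single x)
    then show ?thesis
      using that(1) \<open>hd vs = u\<close> \<open>last vs = w\<close> by simp
  next
    case (step u' v vs' e es')
    then show ?thesis
      using that(2) \<open>hd vs = u\<close> \<open>last vs = w\<close> \<open>distinct vs\<close> by (simp add: path_betw_def)
  qed
qed

lemma path_betw_Cons:
  assumes "path_betw G v w (vs, es)" "u \<in> verts G" "e \<in> edges G" "ends G e = {u, v}"
    "u \<notin> set vs"
  shows "path_betw G u w (u # vs, e # es)"
proof (cases vs)
  case Nil
  then show ?thesis
    using assms(1) by (simp add: path_betw_def walk_def)
next
  case (Cons x xs)
  moreover from this have "x = v"
    using assms(1) by (simp add: path_betw_def)
  ultimately show ?thesis
    using assms by (auto simp: path_betw_def walk_Cons)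
qed

lemma path_betw_suffix:
  "path_betw G v w (vs, es) \<Longrightarrow> x \<in> set vs \<Longrightarrow> \<exists>q. path_betw G x w q \<and> set (snd q) \<subseteq> set es"
proof (induction es arbitrary: v vs)
  case Nil
  from Nil.prems(1) show ?case
  proof (cases rule: path_betw_cases)
    case single
    then show ?thesis
      using Nil.prems by (intro exI[of _ "(vs, [])"]) simp
  qed simp
next
  case (Cons e es)
  from Cons.prems(1) show ?case
  proof (cases rule: path_betw_cases)
    case (step y vs' e' es')
    show ?thesis
    proof (cases "x = v")
      case True
      then show ?thesis
        using Cons.prems(1) by (intro exI[of _ "(vs, e # es)"]) simp
    next
      case False
      then have "x \<in> set (y # vs')"
        using step(1) Cons.prems(2) by simp
      then obtain q where "path_betw G x w q" "set (snd q) \<subseteq> set es"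
        using Cons.IH[of y "y # vs'"] step(2,7) by auto
      then show ?thesis
        by (intro exI[of _ q]) auto
    qed
  qed simp
qed

text \<open>The path edges just before and just after an inner vertex are distinct, because a path
  repeats no edge. They both count towards the degree.\<close>

lemma path_betw_inner_degree:
  assumes G: "finite (edges G)" and p: "path_betw G u v p"
  shows "inner_verts p \<subseteq> internal_nodes G"
proof
  fix x assume x: "x \<in> inner_verts p"
  obtain vs es where pe: "p = (vs, es)"
    by fastforce
  have w: "walk G (vs, es)" "distinct vs"
    using p pe by (auto simp: path_betw_def)
  from x pe have "x \<in> set vs" "x \<noteq> hd vs" "x \<noteq> last vs"
    by (auto simp: inner_verts_def)
  then obtain i where i: "i < length vs" "vs ! i = x"
    by (auto simp: in_set_conv_nth)
  have "vs \<noteq> []"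
    using i by auto
  then have "i \<noteq> 0" "i \<noteq> length vs - 1"
    using i \<open>x \<noteq> hd vs\<close> \<open>x \<noteq> last vs\<close> hd_conv_nth[of vs] last_conv_nth[of vs] by metis+
  \<comment> \<open>The vertex x ends edge m and starts edge m + 1. There is one more vertex than
    edges, so not being the last vertex means that edge m + 1 exists.\<close>
  then obtain m where m: "i = Suc m" "Suc m < length es"
    using i w(1) by (cases i) (auto simp: walk_def)
  let ?D = "{e \<in> edges G. x \<in> ends G e}"
  have "ends G (es ! m) = {vs ! m, x}" "ends G (es ! Suc m) = {x, vs ! Suc (Suc m)}"
    using w(1) m i by (auto simp: walk_def)
  moreover have "es ! m \<in> edges G" "es ! Suc m \<in> edges G"
    using w(1) m nth_mem[of m es] nth_mem[of "Suc m" es] by (auto simp: walk_def)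
  moreover have "es ! m \<noteq> es ! Suc m"
    using walk_distinct_edges[OF w] m by (simp add: nth_eq_iff_index_eq)
  ultimately have "{es ! m, es ! Suc m} \<subseteq> ?D" "card {es ! m, es ! Suc m} = 2"
    by auto
  moreover have "finite ?D"
    using G by simp
  ultimately have "2 \<le> degree G x"
    using card_mono[of ?D "{es ! m, es ! Suc m}"] by (simp add: degree_def)
  moreover have "x \<in> verts G"
    using w(1) \<open>x \<in> set vs\<close> by (auto simp: walk_def)
  ultimately show "x \<in> internal_nodes G"
    by (simp add: internal_nodes_def)
qed

lemma multigraph_other_end:
  assumes "multigraph G" "e \<in> edges G" "u \<in> ends G e"
  obtains v where "ends G e = {u, v}" "u \<noteq> v" "u \<in> verts G" "v \<in> verts G"
proof -
  have "card (ends G e) = 2" and sub: "ends G e \<subseteq> verts G"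
    using assms by (auto simp: multigraph_def)
  then obtain x y where xy: "ends G e = {x, y}" "x \<noteq> y"
    by (auto simp: card_2_iff)
  show ?thesis
  proof (cases "u = x")
    case True
    then show ?thesis
      using xy sub by (intro that[of y]) auto
  next
    case False
    then show ?thesis
      using xy sub assms(3) by (intro that[of x]) auto
  qed
qed

section \<open>Vertices joined by a path\<close>

text \<open>On the vertices this is an equivalence relation whose classes are the components. It
  will be applied to a tree from which an edge or a vertex has been deleted.\<close>

definition joined :: "('v, 'e) mgraph \<Rightarrow> 'v \<Rightarrow> 'v \<Rightarrow> bool" where
  "joined G u v \<longleftrightarrow> (\<exists>p. path_betw G u v p)"

lemma symp_joined: "symp (joined G)"
proof (rule sympI)
  fix u v assume "joined G u v"
  then obtain vs es where "path_betw G u v (vs, es)"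
    by (auto simp: joined_def)
  then show "joined G v u"
    unfolding joined_def by (blast dest: path_betw_rev)
qed

text \<open>Induction along the first path; prepending a vertex that already lies on the path is
  replaced by passing to a suffix.\<close>

lemma transp_joined: "transp (joined G)"
proof (rule transpI)
  fix u v w assume "joined G u v" and vw: "joined G v w"
  then obtain vs es where "path_betw G u v (vs, es)"
    by (auto simp: joined_def)
  then show "joined G u w"
  proof (induction es arbitrary: u vs)
    case Nil
    from Nil.prems show ?case
      by (cases rule: path_betw_cases) (use vw in auto)
  next
    case (Cons e es)
    from Cons.prems show ?case
    proof (cases rule: path_betw_cases)
      case (step y vs' e' es')
      then have "joined G y w"
        using Cons.IH by blast
      then obtain xs fs where q: "path_betw G y w (xs, fs)"
        by (auto simp: joined_def)
      show ?thesis
        unfolding joined_def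
        using path_betw_suffix[OF q, of u] path_betw_Cons[OF q step(3-5)] by blast
    qed simp
  qed
qed

lemma joined_via: "joined G u v \<Longrightarrow> joined G w v \<Longrightarrow> joined G u w"
  by (rule transpD[OF transp_joined _ sympD[OF symp_joined]])

text \<open>Covers edge deletion and vertex deletion at once. Edges at a deleted vertex may stay: no
  walk can use them, since a walk visits both ends of each of its edges and stays inside
  \<open>verts\<close>.\<close>

definition restrict :: "('v, 'e) mgraph \<Rightarrow> 'v set \<Rightarrow> 'e set \<Rightarrow> ('v, 'e) mgraph" where
  "restrict G V E = G\<lparr>verts := V, edges := E\<rparr>"

lemma path_betw_restrict_iff:
  assumes "V \<subseteq> verts G" "E \<subseteq> edges G"
  shows "path_betw (restrict G V E) u v p \<longleftrightarrow>
    path_betw G u v p \<and> set (fst p) \<subseteq> V \<and> set (snd p) \<subseteq> E"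
  using assms by (cases p) (auto simp: path_betw_def walk_def restrict_def)

section \<open>Trees\<close>

lemma cycle_of_path_and_edge:
  assumes p: "path_betw G x y (vs, es)" and f: "f \<in> edges G" "ends G f = {x, y}" "f \<notin> set es"
  shows "cycle G (y # vs, f # es)"
proof -
  have w: "walk G (vs, es)" "distinct vs" "hd vs = x" "last vs = y"
    using p by (auto simp: path_betw_def)
  then obtain xs where vs: "vs = x # xs"
    by (cases vs) (auto simp: walk_def)
  then have "y \<in> set vs"
    using w(4) last_in_set[of vs] by simp
  then have "y \<in> verts G"
    using w(1) by (auto simp: walk_def)
  then show ?thesis
    using w vs f walk_distinct_edges[OF w(1,2)]
    by (auto simp: cycle_def walk_Cons insert_commute)
qed

text \<open>A path between the ends of f that avoids f would close up with f to a cycle. This is the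
  form in which acyclicity is used from here on.\<close>

lemma tree_no_detour:
  assumes "tree T" "f \<in> edges T" "ends T f = {x, y}"
  shows "\<not> joined (restrict T (verts T) (edges T - {f})) x y"
proof
  assume "joined (restrict T (verts T) (edges T - {f})) x y"
  then obtain p where "path_betw T x y p" "set (snd p) \<subseteq> edges T - {f}"
    by (auto simp: joined_def path_betw_restrict_iff)
  then have "cycle T (y # fst p, f # snd p)"
    using assms by (intro cycle_of_path_and_edge[of T x y]) auto
  then show False
    using assms(1) by (auto simp: tree_def)
qed

text \<open>Induction along the first path: the two paths must leave u by the same edge, and then
  the remainders agree.\<close>

lemma tree_path_unique:
  assumes T: "tree T"
  shows "path_betw T u v (vs, es) \<Longrightarrow> path_betw T u v (vs', es') \<Longrightarrow> vs = vs' \<and> es = es'"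
proof (induction es arbitrary: u vs vs' es')
  case Nil
  from Nil.prems(1) have "vs = [u]" "u = v"
    by (cases rule: path_betw_cases; simp)+
  from Nil.prems(2) show ?case
  proof (cases rule: path_betw_cases)
    \<comment> \<open>A nontrivial second path would end at v = u and thus repeat its first
      vertex.\<close>
    case (step y xs e fs)
    then have "v \<in> set (y # xs)"
      using last_in_set[of "y # xs"] by (auto simp: path_betw_def)
    then show ?thesis
      using step \<open>u = v\<close> by blast
  qed (use \<open>vs = [u]\<close> in simp)
next
  case (Cons e es)
  from Cons.prems(1) obtain y xs where p: "vs = u # y # xs" "u \<in> verts T" "e \<in> edges T"
    "ends T e = {u, y}" "u \<notin> set (y # xs)" "path_betw T y v (y # xs, es)"
    by (cases rule: path_betw_cases) auto
  have "u \<noteq> v"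
    using p(5,6) last_in_set[of "y # xs"] by (auto simp: path_betw_def)
  with Cons.prems(2) obtain z zs f fs where q: "vs' = u # z # zs" "es' = f # fs"
    "ends T f = {u, z}" "u \<notin> set (z # zs)" "path_betw T z v (z # zs, fs)" "f \<in> edges T"
    by (cases rule: path_betw_cases) auto
  have "e = f"
  proof (rule ccontr)
    assume "e \<noteq> f"
    \<comment> \<open>Without e, the rest of the first path still joins y to v and the whole second
      path still joins u to v: neither rest meets u, hence neither contains e. So u and y are joined
      without e, a detour around e.\<close>
    let ?H = "restrict T (verts T) (edges T - {e})"
    have "e \<notin> set es"
      using walk_ends_subset[of T "y # xs" es e] p by (auto simp: path_betw_def)
    then have "path_betw ?H y v (y # xs, es)"
      using p(6) by (auto simp: path_betw_restrict_iff) (auto simp: path_betw_def walk_def)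
    moreover have "e \<notin> set fs"
      using walk_ends_subset[of T "z # zs" fs e] p q by (auto simp: path_betw_def)
    then have "path_betw ?H u v (vs', es')"
      using Cons.prems(2) q(2) \<open>e \<noteq> f\<close>
      by (auto simp: path_betw_restrict_iff) (auto simp: path_betw_def walk_def)
    ultimately have "joined ?H y v" "joined ?H u v"
      by (auto simp: joined_def)
    then have "joined ?H u y"
      by (blast intro: joined_via)
    then show False
      using tree_no_detour[OF T p(3,4)] by simp
  qed
  moreover from this have "z = y"
    using p(4) q(3) by (metis doubleton_eq_iff)
  ultimately show ?case
    using Cons.IH[OF p(6)] p(1) q by auto
qed

lemma path_betw_tree_path:
  assumes "tree T" "u \<in> verts T" "v \<in> verts T"
  shows "path_betw T u v (tree_path T u v)"
  unfolding tree_path_def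
proof (rule theI')
  have "\<exists>p. path_betw T u v p"
    using assms by (simp add: tree_def connected_graph_def)
  then show "\<exists>!p. path_betw T u v p"
    using tree_path_unique[OF assms(1)] by (metis surj_pair)
qed

lemma tree_path_eq:
  assumes "tree T" "path_betw T u v p"
  shows "tree_path T u v = p"
  unfolding tree_path_def
proof (rule the_equality[where P = "path_betw T u v", OF assms(2)])
  show "q = p" if "path_betw T u v q" for q
    using tree_path_unique[OF assms(1), of u v "fst q" "snd q" "fst p" "snd p"] that assms(2)
    by (simp add: prod_eq_iff)
qed

text \<open>By uniqueness, the only path that can survive the restriction is the tree path
  itself.\<close>

lemma joined_restrict_iff:
  assumes "tree T" "u \<in> verts T" "v \<in> verts T" "V \<subseteq> verts T" "E \<subseteq> edges T"
  shows "joined (restrict T V E) u v \<longleftrightarrow>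
    set (fst (tree_path T u v)) \<subseteq> V \<and> set (snd (tree_path T u v)) \<subseteq> E"
  unfolding joined_def path_betw_restrict_iff[OF assms(4,5)]
proof
  assume "\<exists>p. path_betw T u v p \<and> set (fst p) \<subseteq> V \<and> set (snd p) \<subseteq> E"
  then obtain p where "path_betw T u v p" "set (fst p) \<subseteq> V" "set (snd p) \<subseteq> E"
    by blast
  then show "set (fst (tree_path T u v)) \<subseteq> V \<and> set (snd (tree_path T u v)) \<subseteq> E"
    by (simp add: tree_path_eq[OF assms(1)])
qed (use path_betw_tree_path[OF assms(1-3)] in blast)

section \<open>Prolonging tree paths to leaves\<close>

text \<open>The path avoids f, since its first edge is e and its later edges miss u. If the other
  end z of f lay on the path, then z and u would both be joined to v without f, a detour around
  f.\<close>

lemma tree_path_extend_edge: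
  assumes T: "tree T" and p: "path_betw T u v (vs, e # es)"
    and f: "f \<in> edges T" "u \<in> ends T f" "f \<noteq> e"
  obtains z where "path_betw T z v (z # vs, f # e # es)"
proof -
  obtain z where "ends T f = {u, z}" and zT: "z \<in> verts T"
    using multigraph_other_end T f(1,2) unfolding tree_def by metis
  then have z: "ends T f = {z, u}"
    by (simp add: insert_commute)
  have "z \<notin> set vs"
  proof
    assume zv: "z \<in> set vs"
    obtain y xs where s: "vs = u # y # xs" "u \<notin> set (y # xs)" "walk T (y # xs, es)"
      using p by (cases rule: path_betw_cases) (auto simp: path_betw_def)
    then have "f \<notin> set (e # es)"
      using walk_ends_subset[of T "y # xs" es f] f by auto
    let ?H = "restrict T (verts T) (edges T - {f})"
    have H: "path_betw ?H u v (vs, e # es)"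
      using p \<open>f \<notin> set (e # es)\<close>
      by (auto simp: path_betw_restrict_iff) (auto simp: path_betw_def walk_def)
    then have "joined ?H z v"
      using path_betw_suffix[OF H zv] by (auto simp: joined_def)
    moreover have "joined ?H u v"
      using H by (auto simp: joined_def)
    ultimately have "joined ?H z u"
      by (blast intro: joined_via)
    then show False
      using tree_no_detour[OF T f(1) z] by simp
  qed
  then show ?thesis
    using that path_betw_Cons[OF p zT f(1) z] by simp
qed

lemma internal_node_other_edge:
  assumes "v \<in> internal_nodes T"
  obtains f where "f \<in> edges T" "v \<in> ends T f" "f \<noteq> e"
proof -
  have "\<not> {f \<in> edges T. v \<in> ends T f} \<subseteq> {e}"
    using assms card_mono[of "{e}" "{f \<in> edges T. v \<in> ends T f}"]
    by (auto simp: internal_nodes_def degree_def)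
  then show ?thesis
    using that by blast
qed

lemma inner_verts_Cons: "distinct (z # vs) \<Longrightarrow> inner_verts (vs, es) \<subseteq> inner_verts (z # vs, fs)"
  by (cases vs) (auto simp: inner_verts_def)

text \<open>While the head is not a leaf it has an edge besides the first edge of the path, and the
  path can be prolonged there. This stops because a path has at most \<open>card (verts T)\<close>
  vertices.\<close>

lemma tree_path_extend_hd_leaf:
  assumes T: "tree T" and p: "path_betw T u v (vs, es)" "es \<noteq> []"
  shows "\<exists>u' vs' es'. path_betw T u' v (vs', es') \<and> u' \<in> leaves T \<and>
    inner_verts (vs, es) \<subseteq> inner_verts (vs', es') \<and> set es \<subseteq> set es'"
  using p
proof (induction "card (verts T) - length vs" arbitrary: u vs es rule: less_induct)
  case less
  have u: "u \<in> verts T"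
    using less.prems(1) by (cases rule: path_betw_cases) auto
  show ?case
  proof (cases "u \<in> leaves T")
    case True
    then show ?thesis
      using less.prems(1) by blast
  next
    case False
    then have "u \<in> internal_nodes T"
      using u by (simp add: leaves_def)
    obtain e es0 where es: "es = e # es0"
      using less.prems(2) by (cases es) auto
    obtain f where "f \<in> edges T" "u \<in> ends T f" "f \<noteq> e"
      using internal_node_other_edge \<open>u \<in> internal_nodes T\<close> by metis
    then obtain z where z: "path_betw T z v (z # vs, f # es)"
      using tree_path_extend_edge[OF T] less.prems(1) es by metis
    then have "distinct (z # vs)" "set (z # vs) \<subseteq> verts T"
      by (auto simp: path_betw_def walk_def)
    moreover have "finite (verts T)"
      using T by (simp add: tree_def multigraph_def)
    ultimately have "length (z # vs) \<le> card (verts T)"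
      by (metis card_mono distinct_card)
    then have "card (verts T) - length (z # vs) < card (verts T) - length vs"
      by simp
    then obtain u' vs' es' where "path_betw T u' v (vs', es')" "u' \<in> leaves T"
      "inner_verts (z # vs, f # es) \<subseteq> inner_verts (vs', es')" "set (f # es) \<subseteq> set es'"
      using less.hyps[OF _ z] by blast
    then show ?thesis
      using inner_verts_Cons[OF \<open>distinct (z # vs)\<close>, of es "f # es"]
      by (metis insert_subset list.simps(15) subset_trans)
  qed
qed

lemma inner_verts_rev: "inner_verts (rev vs, rev es) = inner_verts (vs, es)"
  by (cases "vs = []") (auto simp: inner_verts_def hd_rev last_rev)

text \<open>Prolong at the head, reverse, and prolong at the new head. Reversal changes neither the
  edge set nor the inner vertices.\<close>

lemma tree_path_extend_leaves:
  assumes T: "tree T" and p: "path_betw T u v (vs, es)" "es \<noteq> []"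
  obtains u' v' where "u' \<in> leaves T" "v' \<in> leaves T"
    "inner_verts (vs, es) \<subseteq> inner_verts (tree_path T u' v')"
    "set es \<subseteq> set (snd (tree_path T u' v'))"
proof -
  obtain u' vs1 es1 where 1: "path_betw T u' v (vs1, es1)" "u' \<in> leaves T"
    "inner_verts (vs, es) \<subseteq> inner_verts (vs1, es1)" "set es \<subseteq> set es1"
    using tree_path_extend_hd_leaf[OF assms] by blast
  then have "rev es1 \<noteq> []"
    using p(2) by auto
  then obtain v' vs2 es2 where 2: "path_betw T v' u' (vs2, es2)" "v' \<in> leaves T"
    "inner_verts (rev vs1, rev es1) \<subseteq> inner_verts (vs2, es2)" "set (rev es1) \<subseteq> set es2"
    using tree_path_extend_hd_leaf[OF T path_betw_rev[OF 1(1)]] by blast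
  then have "tree_path T v' u' = (vs2, es2)"
    using tree_path_eq[OF T] by blast
  then show ?thesis
    using that[of v' u'] 1 2 by (auto simp: inner_verts_rev)
qed

lemma tree_edge_between_leaves:
  assumes T: "tree T" and e: "e \<in> edges T"
  obtains u v where "u \<in> leaves T" "v \<in> leaves T" "e \<in> set (snd (tree_path T u v))"
proof -
  have "card (ends T e) = 2" "ends T e \<subseteq> verts T"
    using T e by (auto simp: tree_def multigraph_def)
  then obtain x y where "ends T e = {x, y}" "x \<noteq> y" "x \<in> verts T" "y \<in> verts T"
    by (auto simp: card_2_iff)
  then have "path_betw T x y ([x, y], [e])"
    using e by (simp add: path_betw_def walk_Cons walk_single)
  then show ?thesis
    using tree_path_extend_leaves[OF T] that by (metis insert_subset list.distinct(1) list.simps(15))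
qed

text \<open>A single edge at w has w as an end, not as an inner vertex. Therefore the path prolonged
  to leaves consists of two edges with w in the middle.\<close>

lemma tree_internal_node_between_leaves:
  assumes T: "tree T" and w: "w \<in> internal_nodes T"
  obtains u v where "u \<in> leaves T" "v \<in> leaves T" "w \<in> inner_verts (tree_path T u v)"
proof -
  obtain e where e: "e \<in> edges T" "w \<in> ends T e"
    using internal_node_other_edge[OF w] by metis
  obtain y where "ends T e = {w, y}" "w \<noteq> y" "w \<in> verts T" "y \<in> verts T"
    using multigraph_other_end T e unfolding tree_def by metis
  then have p: "path_betw T w y ([w, y], [e])"
    using e by (simp add: path_betw_def walk_Cons walk_single)
  obtain f where "f \<in> edges T" "w \<in> ends T f" "f \<noteq> e"
    using internal_node_other_edge[OF w] by metis
  then obtain z where z: "path_betw T z y ([z, w, y], [f, e])"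
    using tree_path_extend_edge[OF T p] by metis
  then have "w \<in> inner_verts ([z, w, y], [f, e])"
    by (auto simp: path_betw_def inner_verts_def)
  moreover obtain u v where "u \<in> leaves T" "v \<in> leaves T"
    "inner_verts ([z, w, y], [f, e]) \<subseteq> inner_verts (tree_path T u v)"
    by (rule tree_path_extend_leaves[OF T z]) simp_all
  ultimately show ?thesis
    by (intro that[of u v]) auto
qed

section \<open>Pairs of Steiner trees\<close>

lemma steiner_trees_common_edge:
  assumes S: "steiner_tree G R S" "steiner_tree G R T" and e: "e \<in> edges S" "e \<in> edges T"
  shows "\<exists>u\<in>R. \<exists>v\<in>R. u \<noteq> v \<and>
    e \<in> set (snd (tree_path S u v)) \<and> e \<in> set (snd (tree_path T u v))"
proof -
  let ?H = "\<lambda>T. restrict T (verts T) (edges T - {e})"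
  have H: "joined (?H T) u v \<longleftrightarrow> e \<notin> set (snd (tree_path T u v))"
    if "steiner_tree G R T" "u \<in> R" "v \<in> R" for T :: "('a, 'b) mgraph" and u v
  proof -
    have *: "tree T" "u \<in> verts T" "v \<in> verts T"
      using that by (auto simp: steiner_tree_def)
    then show ?thesis
      using path_betw_tree_path[OF *]
      by (auto simp: joined_restrict_iff) (auto simp: path_betw_def walk_def)
  qed
  \<comment> \<open>The tree path between two leaves through e provides the pair, since leaves are
    terminals.\<close>
  have ex: "\<exists>u\<in>R. \<exists>v\<in>R. \<not> joined (?H T) u v"
    if "steiner_tree G R T" "e \<in> edges T" for T :: "('a, 'b) mgraph"
    using that H[OF that(1)] tree_edge_between_leaves[of T e]
    by (metis steiner_tree_def subsetD)
  obtain u v where uv: "u \<in> R" "v \<in> R" "\<not> joined (?H S) u v" "\<not> joined (?H T) u v"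
    using ex_common_unrelated_pair[OF symp_joined transp_joined symp_joined transp_joined
        ex[OF S(1) e(1)] ex[OF S(2) e(2)]] by blast
  \<comment> \<open>The one-vertex path joins u to itself, so an unjoined pair is distinct.\<close>
  moreover have "u \<noteq> v"
  proof
    assume "u = v"
    moreover have "path_betw (?H S) u u ([u], [])"
      using S(1) uv(1) by (auto simp: restrict_def path_betw_def walk_single steiner_tree_def)
    ultimately show False
      using uv(3) by (auto simp: joined_def)
  qed
  ultimately show ?thesis
    using H[OF S(1) uv(1,2)] H[OF S(2) uv(1,2)] by blast
qed

lemma steiner_trees_common_internal_node:
  assumes S: "steiner_tree G R S" "steiner_tree G R T"
    and w: "w \<in> internal_nodes S" "w \<in> internal_nodes T"
  shows "\<exists>u\<in>R. \<exists>v\<in>R. u \<noteq> v \<and>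
    w \<in> inner_verts (tree_path S u v) \<and> w \<in> inner_verts (tree_path T u v)"
proof -
  let ?H = "\<lambda>T. restrict T (verts T - {w}) (edges T)"
  \<comment> \<open>The node w may itself be a terminal. As an end of the path it is not an inner
    vertex, yet after its deletion nothing is joined to it; so the equivalence is restricted to the
    other terminals.\<close>
  have H: "joined (?H T) u v \<longleftrightarrow> w \<notin> inner_verts (tree_path T u v)"
    if "steiner_tree G R T" "u \<in> R - {w}" "v \<in> R - {w}" for T :: "('a, 'b) mgraph" and u v
  proof -
    have *: "tree T" "u \<in> verts T" "v \<in> verts T"
      using that by (auto simp: steiner_tree_def)
    have p: "path_betw T u v (tree_path T u v)"
      by (rule path_betw_tree_path[OF *])
    then have "w \<in> inner_verts (tree_path T u v) \<longleftrightarrow> w \<in> set (fst (tree_path T u v))"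
      using that by (auto simp: inner_verts_def path_betw_def)
    then show ?thesis
      using p by (simp add: joined_restrict_iff[OF *]) (auto simp: path_betw_def walk_def)
  qed
  have ex: "\<exists>u\<in>R - {w}. \<exists>v\<in>R - {w}. \<not> joined (?H T) u v"
    if T: "steiner_tree G R T" "w \<in> internal_nodes T" for T :: "('a, 'b) mgraph"
  proof -
    obtain u v where "u \<in> leaves T" "v \<in> leaves T" "w \<in> inner_verts (tree_path T u v)"
      using T tree_internal_node_between_leaves[of T w] by (auto simp: steiner_tree_def)
    \<comment> \<open>Leaves are terminals, and they differ from w because w is internal.\<close>
    moreover from this have "u \<in> R - {w}" "v \<in> R - {w}"
      using T by (auto simp: steiner_tree_def leaves_def)
    ultimately show ?thesis
      using H[OF T(1)] by blast
  qed
  obtain u v where uv: "u \<in> R - {w}" "v \<in> R - {w}"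
    "\<not> joined (?H S) u v" "\<not> joined (?H T) u v"
    using ex_common_unrelated_pair[OF symp_joined transp_joined symp_joined transp_joined
        ex[OF S(1) w(1)] ex[OF S(2) w(2)]] by blast
  moreover have "u \<noteq> v"
  proof
    assume "u = v"
    moreover have "path_betw (?H S) u u ([u], [])"
      using S(1) uv(1) by (auto simp: restrict_def path_betw_def walk_single steiner_tree_def)
    ultimately show False
      using uv(3) by (auto simp: joined_def)
  qed
  ultimately show ?thesis
    using H[OF S(1) uv(1,2)] H[OF S(2) uv(1,2)] by blast
qed

text \<open>For the converse direction: disjointness of the trees is inherited by the paths inside
  them.\<close>

lemma steiner_tree_path_subset:
  assumes T: "steiner_tree G R T" and "u \<in> R" "v \<in> R"
  shows "set (snd (tree_path T u v)) \<subseteq> edges T"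
    and "inner_verts (tree_path T u v) \<subseteq> internal_nodes T"
proof -
  have "tree T" "u \<in> verts T" "v \<in> verts T"
    using assms by (auto simp: steiner_tree_def)
  then have p: "path_betw T u v (tree_path T u v)"
    by (rule path_betw_tree_path)
  then show "set (snd (tree_path T u v)) \<subseteq> edges T"
    by (auto simp: path_betw_def walk_def)
  show "inner_verts (tree_path T u v) \<subseteq> internal_nodes T"
    using p \<open>tree T\<close> by (intro path_betw_inner_degree) (auto simp: tree_def multigraph_def)
qed

section \<open>CISTs characterized by pairwise disjointness\<close>

theorem theorem3p2:
  fixes G :: "('v, 'e) mgraph" and R :: "'v set" and k :: nat
    and T :: "nat \<Rightarrow> ('v, 'e) mgraph"
  assumes "multigraph G" and "connected_graph G"
    and "R \<subseteq> verts G" and "card R \<ge> 2"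
    and "\<forall>i\<in>{1..k}. steiner_tree G R (T i)"
  shows "CIST G R k T \<longleftrightarrow>
    (\<forall>i\<in>{1..k}. \<forall>j\<in>{1..k}. i \<noteq> j \<longrightarrow>
       edges (T i) \<inter> edges (T j) = {} \<and> internal_nodes (T i) \<inter> internal_nodes (T j) = {})"
proof
  assume C: "CIST G R k T"
  show "\<forall>i\<in>{1..k}. \<forall>j\<in>{1..k}. i \<noteq> j \<longrightarrow>
       edges (T i) \<inter> edges (T j) = {} \<and> internal_nodes (T i) \<inter> internal_nodes (T j) = {}"
  proof (intro ballI impI)
    fix i j assume ij: "i \<in> {1..k}" "j \<in> {1..k}" "i \<noteq> j"
    have S: "steiner_tree G R (T i)" "steiner_tree G R (T j)"
      using assms(5) ij by auto
    have D: "edge_disjoint (tree_path (T i) u v) (tree_path (T j) u v)"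
      "internally_vertex_disjoint (tree_path (T i) u v) (tree_path (T j) u v)"
      if "u \<in> R" "v \<in> R" "u \<noteq> v" for u v
      using C ij that by (auto simp: CIST_def)
    \<comment> \<open>A common edge would lie on both tree paths between some two distinct
      terminals.\<close>
    have "edges (T i) \<inter> edges (T j) = {}"
      using steiner_trees_common_edge[OF S] D(1) by (fastforce simp: edge_disjoint_def)
    moreover have "internal_nodes (T i) \<inter> internal_nodes (T j) = {}"
      using steiner_trees_common_internal_node[OF S] D(2)
      by (fastforce simp: internally_vertex_disjoint_def)
    ultimately show "edges (T i) \<inter> edges (T j) = {} \<and>
        internal_nodes (T i) \<inter> internal_nodes (T j) = {}"
      by blast
  qed
next
  assume D: "\<forall>i\<in>{1..k}. \<forall>j\<in>{1..k}. i \<noteq> j \<longrightarrow>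
       edges (T i) \<inter> edges (T j) = {} \<and> internal_nodes (T i) \<inter> internal_nodes (T j) = {}"
  show "CIST G R k T"
    unfolding CIST_def edge_disjoint_def internally_vertex_disjoint_def
  proof (intro conjI ballI impI)
    fix u v i j
    assume uv: "u \<in> R" "v \<in> R" and ij: "i \<in> {1..k}" "j \<in> {1..k}" "i \<noteq> j"
    have S: "steiner_tree G R (T i)" "steiner_tree G R (T j)"
      using assms(5) ij by auto
    show "set (snd (tree_path (T i) u v)) \<inter> set (snd (tree_path (T j) u v)) = {}"
      using steiner_tree_path_subset(1)[OF S(1) uv] steiner_tree_path_subset(1)[OF S(2) uv] D ij
      by blast
    show "inner_verts (tree_path (T i) u v) \<inter> inner_verts (tree_path (T j) u v) = {}"
      using steiner_tree_path_subset(2)[OF S(1) uv] steiner_tree_path_subset(2)[OF S(2) uv] D ij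
      by blast
  qed (use assms(5) in blast)
qed

end
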